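(* Let $E,F$ be Banach spaces, $U\subset E$ open, $g:U\to F$ a $C^1$ map, and $f:U\to\mathbb{R}$ a $C^1$ (not necessarily linear) functional. Let $y_0\in F$ be a generalized regular value of $g$ and $S=g^{-1}(y_0)$. If $x\in U$ is a critical point of $f|_S$, then $$N(f'(x))\supset N(g'(x))\quad\text{and}\quad g(x)=y_0 .$$
   Context: $N(\cdot)$ and $R(\cdot)$ denote null space and range of an operator; $g'(x),f'(x)$ are Fréchet derivatives. A bounded linear operator $A:E\to F$ is double split if $R(A)$ is closed and there are closed subspaces $R_+\subset E$, $N_+\subset F$ with $E=N(A)\oplus R_+$ and $F=R(A)\oplus N_+$. A point $x_0\in U$ is a generalized regular point of $g$ if $g'(x_0)$ is double split, $F=R(g'(x_0))\oplus N_+$ with $N_+$ a closed subspace, and there is a neighborhood $U_0\subset U$ of $x_0$ such that $R(g'(x))\cap N_+=\{0\}$ for all $x\in U_0$. The element $y_0\in F$ is a generalized regular value of $g$ if $g^{-1}(y_0)$ is empty or consists only of generalized regular points; in that case $S=g^{-1}(y_0)$ is a $C^1$ submanifold of $U$ with $T_xS=N(g'(x))$ for $x\in S$ (known result). A point $x$ is a critical point of $f|_S$ if $x\in S$ and, for every $C^1$ curve $c:(-\varepsilon,\varepsilon)\to U$ with values in $S$ and $c(0)=x$, one has $\frac{d}{dt}f(c(t))|_{t=0}=0$. *)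

theory Defs
  imports "HOL-Analysis.Analysis"
begin

definition C1_on :: "'a::real_normed_vector set \<Rightarrow> ('a \<Rightarrow> 'b::real_normed_vector) \<Rightarrow> bool"
  where "C1_on U g \<longleftrightarrow>
    (\<exists>g' :: 'a \<Rightarrow> 'a \<Rightarrow>\<^sub>L 'b.
       (\<forall>x\<in>U. (g has_derivative blinfun_apply (g' x)) (at x)) \<and> continuous_on U g')"

definition nullspace :: "('a::real_vector \<Rightarrow> 'b::real_vector) \<Rightarrow> 'a set"
  where "nullspace A = {h. A h = 0}"

definition direct_sum_decomp :: "'a::real_vector set \<Rightarrow> 'a set \<Rightarrow> bool"
  where "direct_sum_decomp V W \<longleftrightarrow>
    subspace V \<and> subspace W \<and> V \<inter> W = {0} \<and> (\<forall>x. \<exists>v\<in>V. \<exists>w\<in>W. x = v + w)"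

definition double_split :: "('a::real_normed_vector \<Rightarrow> 'b::real_normed_vector) \<Rightarrow> bool"
  where "double_split A \<longleftrightarrow>
    bounded_linear A \<and> closed (range A) \<and>
    (\<exists>Rp. closed Rp \<and> direct_sum_decomp (nullspace A) Rp) \<and>
    (\<exists>Np. closed Np \<and> direct_sum_decomp (range A) Np)"

text \<open>The complement of the range in the next definition is existentially quantified:
  one closed complement that works near the point is enough.\<close>

definition generalized_regular_point ::
    "'a::real_normed_vector set \<Rightarrow> ('a \<Rightarrow> 'b::real_normed_vector) \<Rightarrow> 'a \<Rightarrow> bool"
  where "generalized_regular_point U g x0 \<longleftrightarrow>
    x0 \<in> U \<and>
    double_split (frechet_derivative g (at x0)) \<and>
    (\<exists>Np. closed Np \<and> direct_sum_decomp (range (frechet_derivative g (at x0))) Np \<and>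
       (\<exists>U0. open U0 \<and> x0 \<in> U0 \<and> U0 \<subseteq> U \<and>
          (\<forall>x\<in>U0. range (frechet_derivative g (at x)) \<inter> Np = {0})))"

text \<open>HOL functions are total, so the preimage of a value under a map defined on \<open>U\<close>
  is taken inside \<open>U\<close>.\<close>

definition level_set :: "'a set \<Rightarrow> ('a \<Rightarrow> 'b) \<Rightarrow> 'b \<Rightarrow> 'a set"
  where "level_set U g y0 = {x \<in> U. g x = y0}"

definition generalized_regular_value ::
    "'a::real_normed_vector set \<Rightarrow> ('a \<Rightarrow> 'b::real_normed_vector) \<Rightarrow> 'b \<Rightarrow> bool"
  where "generalized_regular_value U g y0 \<longleftrightarrow>
    (\<forall>x\<in>level_set U g y0. generalized_regular_point U g x)"

text \<open>Below, \<open>S\<close> is a subset of the domain of \<open>f\<close>, so curves with values in \<open>S\<close> are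
  automatically curves in that domain; they are \<open>C\<^sup>1\<close> as maps into the ambient space.\<close>

definition critical_point_on ::
    "('a::real_normed_vector \<Rightarrow> real) \<Rightarrow> 'a set \<Rightarrow> 'a \<Rightarrow> bool"
  where "critical_point_on f S x \<longleftrightarrow>
    x \<in> S \<and>
    (\<forall>\<epsilon>>0. \<forall>c :: real \<Rightarrow> 'a.
       c C1_differentiable_on {-\<epsilon><..<\<epsilon>} \<and> c ` {-\<epsilon><..<\<epsilon>} \<subseteq> S \<and> c 0 = x
       \<longrightarrow> ((\<lambda>t. f (c t)) has_real_derivative 0) (at 0))"

end

theory Submission
  imports Defs
begin

text \<open>
  It suffices to realise every \<open>h\<close> in the null space of \<open>A = g'(x)\<close> as the velocity at
  \<open>0\<close> of a \<open>C\<^sup>1\<close> curve in \<open>S\<close>. By the open mapping theorem, the two splittings yield a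
  bounded \<open>B\<close> with \<open>A B A = A\<close> such that \<open>A B y = 0\<close> only for \<open>y \<in> N\<^sub>+\<close>. The map
  \<open>\<phi>(z) = (z - x) - B A (z - x) + B (g(z) - g(x))\<close> has derivative the identity at \<open>x\<close>, so
  \<open>\<phi>(c(t)) = t h\<close> has a \<open>C\<^sup>1\<close> solution \<open>c\<close>. Applying \<open>A\<close> gives \<open>A B (g(c(t)) - g(x)) = 0\<close>;
  differentiating, \<open>g'(c(t)) c'(t)\<close> lies in \<open>R(g'(c(t))) \<inter> N\<^sub>+ = {0}\<close>. Hence \<open>g \<circ> c\<close> is
  constant.
\<close>

section \<open>Open mapping theorem on a closed subspace\<close>

text \<open>The open mapping theorem for the restriction of \<open>T\<close> to \<open>K\<close>, in
  quantitative form. The series of corrections converges by completeness of the space, and its sum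
  stays in \<open>K\<close> because \<open>K\<close> is a closed subspace. Keeping \<open>K\<close>
  a set rather than a type lets it be a product of two complements below.\<close>

lemma closed_subspace_surj_bounded_preimage:
  fixes T :: "'a::banach \<Rightarrow> 'b::banach"
  assumes T: "bounded_linear T" and K: "closed K" "subspace K" and surj: "T ` K = UNIV"
  obtains C where "\<And>y. \<exists>x\<in>K. T x = y \<and> norm x \<le> C * norm y"
proof -
  interpret T: bounded_linear T by (fact T)
  \<comment> \<open>By Baire, some \<open>V n\<close> contains a ball; halving the residual repeatedly removes the closure.\<close>
  define V where "V n = closure (T ` (K \<inter> cball 0 (real n)))" for n
  have "(\<Union>n. V n) = UNIV"
  proof (intro set_eqI iffI UNIV_I)
    fix y
    obtain x where x: "x \<in> K" "T x = y" using surj by (metis UNIV_I imageE)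
    obtain n where "norm x \<le> real n" using real_arch_simple by blast
    with x have "y \<in> T ` (K \<inter> cball 0 (real n))" by auto
    then show "y \<in> (\<Union>n. V n)" unfolding V_def using closure_subset by fastforce
  qed
  moreover have "euclidean interior_of \<Union> (range V) = {}" if "\<And>n. interior (V n) = {}"
    by (rule Baire_category_alt)
       (use that in \<open>auto simp: completely_metrizable_space_euclidean V_def\<close>)
  ultimately obtain n where "interior (V n) \<noteq> {}" by fastforce
  then obtain z r where r: "r > 0" and sub: "ball z r \<subseteq> V n"
    by (metis ex_in_conv mem_interior)
  \<comment> \<open>A vector \<open>y\<close> is scaled by \<open>s\<close> to norm
    \<open>r / 2\<close>, inside the ball of radius \<open>r\<close>. An approximate preimage there
    has norm at most \<open>2 * n\<close>, and scaling back multiplies by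
    \<open>1 / s = 2 * norm y / r\<close>.\<close>
  define M where "M = 4 * real n / r"
  have near_image: "\<exists>p. p \<in> K \<and> norm p \<le> n \<and> dist (T p) w < d" if "w \<in> V n" "d > 0" for w d
  proof -
    obtain v where "v \<in> T ` (K \<inter> cball 0 (real n))" "dist v w < d"
      using \<open>w \<in> V n\<close> \<open>d > 0\<close> unfolding V_def closure_approachable by blast
    then show ?thesis by auto
  qed
  \<comment> \<open>The ball in \<open>V n\<close> is centred at \<open>z\<close>, not at 0.
    Subtracting approximate preimages of \<open>z + y\<close> and \<open>z\<close> moves the centre
    to 0 and doubles the norm bound.\<close>
  have approx: "\<exists>u\<in>K. norm u \<le> 2 * real n \<and> norm (y - T u) < e" if "norm y < r" "e > 0" for y e
  proof -
    have "z + y \<in> V n" "z \<in> V n" using sub that(1) r by (auto simp: dist_norm subset_eq)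
    then obtain p q where p: "p \<in> K" "norm p \<le> n" "dist (T p) (z + y) < e/2"
      and q: "q \<in> K" "norm q \<le> n" "dist (T q) z < e/2"
      using near_image half_gt_zero[OF \<open>e > 0\<close>] by metis
    have "norm (y - T (p - q)) = norm ((T q - z) - (T p - (z + y)))"
      by (simp add: T.diff algebra_simps)
    also have "\<dots> < e"
      using p(3) q(3) norm_triangle_ineq4[of "T q - z" "T p - (z + y)"] by (simp add: dist_norm)
    finally show ?thesis using p q K(2)
      by (intro bexI[of _ "p - q"]) (auto intro: subspace_diff order_trans[OF norm_triangle_ineq4])
  qed
  have "\<exists>u\<in>K. norm u \<le> M * norm y \<and> norm (y - T u) \<le> norm y / 2" for y
  proof (cases "y = 0")
    case True
    then show ?thesis using K(2) by (intro bexI[of _ 0]) (auto simp: T.zero subspace_0)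
  next
    case False
    define s where "s = r / (2 * norm y)"
    have s: "s > 0" using False r by (simp add: s_def)
    have "norm (s *\<^sub>R y) < r" using False r by (simp add: s_def)
    moreover have "s * norm y / 2 > 0" using s False by simp
    ultimately obtain u where u: "u \<in> K" "norm u \<le> 2 * real n"
      "norm (s *\<^sub>R y - T u) < s * norm y / 2"
      using approx by blast
    show ?thesis
    proof (intro bexI[of _ "u /\<^sub>R s"] conjI)
      show "norm (u /\<^sub>R s) \<le> M * norm y"
        using u(2) s False r by (simp add: s_def M_def field_simps)
      have "norm (y - T (u /\<^sub>R s)) = norm ((s *\<^sub>R y - T u) /\<^sub>R s)"
        using s by (simp add: T.scaleR scaleR_diff_right)
      also have "\<dots> = norm (s *\<^sub>R y - T u) / s" using s by (simp add: divide_inverse mult.commute)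
      also have "\<dots> \<le> norm y / 2" using u(3) s by (simp add: field_simps)
      finally show "norm (y - T (u /\<^sub>R s)) \<le> norm y / 2" .
      show "u /\<^sub>R s \<in> K" using u K by (simp add: subspace_scale)
    qed
  qed
  then obtain u where uK: "\<And>y. u y \<in> K" and un: "\<And>y. norm (u y) \<le> M * norm y"
    and uT: "\<And>y. norm (y - T (u y)) \<le> norm y / 2"
    by metis
  show ?thesis
  proof
    fix y
    \<comment> \<open>\<open>\<rho> k\<close> is the residual after \<open>k\<close> corrections.
      Each correction satisfies \<open>T (u (\<rho> k)) = \<rho> k - \<rho> (Suc k)\<close>, so
      their sum telescopes to a preimage of \<open>y\<close>; the geometric decay with ratio 1/2
      produces the final constant \<open>M * 2\<close>.\<close>
    define \<rho> where "\<rho> k = ((\<lambda>z. z - T (u z)) ^^ k) y" for k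
    have \<rho>0: "\<rho> 0 = y" and \<rho>S: "\<rho> (Suc k) = \<rho> k - T (u (\<rho> k))" for k
      by (simp_all add: \<rho>_def)
    have \<rho>n: "norm (\<rho> k) \<le> norm y * (1/2)^k" for k
    proof (induction k)
      case (Suc k)
      then show ?case using uT[of "\<rho> k"] by (simp add: \<rho>S)
    qed (simp add: \<rho>0)
    have M: "M \<ge> 0" using r by (simp add: M_def)
    have bd: "norm (u (\<rho> k)) \<le> M * norm y * (1/2)^k" for k
      using un[of "\<rho> k"] mult_left_mono[OF \<rho>n[of k] M] by (simp add: mult.assoc)
    have sumb: "(\<lambda>k. M * norm y * (1/2)^k) sums (M * norm y * 2)"
      using sums_mult[OF geometric_sums[of "1/2::real"]] by simp
    have sm: "summable (\<lambda>k. norm (u (\<rho> k)))"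
      by (rule summable_comparison_test'[OF sums_summable[OF sumb]]) (simp add: bd)
    define x where "x = (\<Sum>k. u (\<rho> k))"
    have xs: "(\<lambda>k. u (\<rho> k)) sums x"
      unfolding x_def using summable_norm_cancel[OF sm] by (rule summable_sums)
    have "x \<in> K"
    proof (rule Lim_in_closed_set[OF K(1) _ _ xs[unfolded sums_def]])
      show "\<forall>\<^sub>F m in sequentially. (\<Sum>k<m. u (\<rho> k)) \<in> K"
        using K(2) uK by (intro always_eventually allI subspace_sum) auto
    qed simp
    moreover have "T x = y"
    proof -
      have "(\<lambda>k. T (u (\<rho> k))) sums T x" by (rule T.sums[OF xs])
      moreover have "\<rho> \<longlonglongrightarrow> 0"
      proof (rule Lim_null_comparison)
        show "\<forall>\<^sub>F k in sequentially. norm (\<rho> k) \<le> norm y * (1/2)^k" using \<rho>n by simp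
        show "(\<lambda>k. norm y * (1/2)^k) \<longlonglongrightarrow> 0"
          by (intro tendsto_mult_right_zero LIMSEQ_power_zero) simp
      qed
      then have "(\<lambda>k. \<rho> k - \<rho> (Suc k)) sums (\<rho> 0 - 0)" by (rule telescope_sums')
      ultimately show ?thesis by (simp add: \<rho>S \<rho>0 sums_unique2)
    qed
    moreover have "norm x \<le> (M * 2) * norm y"
    proof -
      have "norm x \<le> (\<Sum>k. norm (u (\<rho> k)))" unfolding x_def by (rule summable_norm[OF sm])
      also have "\<dots> \<le> (\<Sum>k. M * norm y * (1/2)^k)"
        by (rule suminf_le[OF bd sm sums_summable[OF sumb]])
      finally show ?thesis using sums_unique[OF sumb] by (simp add: mult_ac)
    qed
    ultimately show "\<exists>x\<in>K. T x = y \<and> norm x \<le> (M * 2) * norm y" by blast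
  qed
qed

section \<open>Generalized inverse of a double split operator\<close>

text \<open>Every \<open>y\<close> is \<open>A q + n\<close> for exactly one \<open>q\<close> in
  \<open>R\<close> and \<open>n\<close> in \<open>N\<close>, and \<open>B y\<close> is this
  \<open>q\<close>. Thus \<open>A B\<close> is the projection onto \<open>range A\<close> along
  \<open>N\<close>, which fixes the range and has null space \<open>N\<close>. The bound on
  \<open>B\<close> comes from the open mapping theorem for \<open>(q, n) \<mapsto> A q + n\<close>
  on \<open>R \<times> N\<close>.\<close>

lemma double_split_generalized_inverse:
  fixes A :: "'a::banach \<Rightarrow> 'b::banach"
  assumes A: "bounded_linear A"
    and R: "closed R" "direct_sum_decomp (nullspace A) R"
    and N: "closed N" "direct_sum_decomp (range A) N"
  obtains B where "bounded_linear B" "\<And>v. A (B (A v)) = A v" "\<And>y. A (B y) = 0 \<Longrightarrow> y \<in> N"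
proof -
  interpret A: bounded_linear A by (fact A)
  have sR: "subspace R" and sN: "subspace N" and AN: "range A \<inter> N = {0}"
    and NR: "nullspace A \<inter> R = {0}"
    using R N by (auto simp: direct_sum_decomp_def)
  have T: "bounded_linear (\<lambda>p. A (fst p) + snd p)"
    by (intro bounded_linear_add bounded_linear_compose[OF A] bounded_linear_fst bounded_linear_snd)
  have "\<exists>p\<in>R \<times> N. y = A (fst p) + snd p" for y
  proof -
    obtain v n where v: "n \<in> N" "y = A v + n"
      using N(2) unfolding direct_sum_decomp_def by blast
    obtain k q where "A k = 0" "q \<in> R" "v = k + q"
      using R(2) unfolding direct_sum_decomp_def nullspace_def by blast
    with v show ?thesis by (intro bexI[of _ "(q, n)"]) (auto simp: A.add)
  qed
  then have "(\<lambda>p. A (fst p) + snd p) ` (R \<times> N) = UNIV" by blast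
  from closed_subspace_surj_bounded_preimage[OF T closed_Times[OF R(1) N(1)]
      subspace_Times[OF sR sN] this]
  obtain C where C: "\<And>y. \<exists>p\<in>R \<times> N. A (fst p) + snd p = y \<and> norm p \<le> C * norm y"
    by blast
  have "\<exists>q. q \<in> R \<and> y - A q \<in> N \<and> norm q \<le> C * norm y" for y
  proof -
    obtain p where p: "p \<in> R \<times> N" "A (fst p) + snd p = y" "norm p \<le> C * norm y"
      using C by blast
    have "norm (fst p) \<le> norm p" using norm_fst_le[of "fst p" "snd p"] by simp
    with p show ?thesis by (intro exI[of _ "fst p"]) auto
  qed
  then obtain B where B: "\<And>y. B y \<in> R" "\<And>y. y - A (B y) \<in> N" "\<And>y. norm (B y) \<le> C * norm y"
    by metis
  \<comment> \<open>\<open>B\<close> was obtained by pointwise choice, so its linearity has to be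
    forced by uniqueness: the trivial intersection with \<open>N\<close> puts \<open>B y - q\<close>
    into the null space, and the trivial intersection with \<open>R\<close> makes it zero.\<close>
  have uniq: "B y = q" if "q \<in> R" "y - A q \<in> N" for y q
  proof -
    have "A (B y - q) = (y - A q) - (y - A (B y))" by (simp add: A.diff)
    then have "A (B y - q) \<in> N" using subspace_diff[OF sN that(2) B(2)[of y]] by (simp only:)
    then have "B y - q \<in> nullspace A" using AN by (auto simp: nullspace_def)
    moreover have "B y - q \<in> R" by (rule subspace_diff[OF sR B(1) that(1)])
    ultimately have "B y - q \<in> {0}" using NR by blast
    then show ?thesis by simp
  qed
  show ?thesis
  proof
    show "bounded_linear B"
    proof (rule bounded_linear_intro)
      show "B (y + z) = B y + B z" for y z
      proof (rule uniq)
        have "y + z - A (B y + B z) = (y - A (B y)) + (z - A (B z))" by (simp add: A.add)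
        then show "y + z - A (B y + B z) \<in> N"
          using subspace_add[OF sN B(2)[of y] B(2)[of z]] by (simp only:)
      qed (use B sR in \<open>simp add: subspace_add\<close>)
      show "B (s *\<^sub>R y) = s *\<^sub>R B y" for s y
      proof (rule uniq)
        have "s *\<^sub>R y - A (s *\<^sub>R B y) = s *\<^sub>R (y - A (B y))"
          by (simp add: A.scaleR scaleR_diff_right)
        then show "s *\<^sub>R y - A (s *\<^sub>R B y) \<in> N"
          using subspace_scale[OF sN B(2)[of y]] by (simp only:)
      qed (use B sR in \<open>simp add: subspace_scale\<close>)
      show "norm (B y) \<le> norm y * C" for y using B(3) by (simp add: mult.commute)
    qed
    show "A (B (A v)) = A v" for v
    proof -
      have "A v - A (B (A v)) \<in> range A \<inter> N"
        using B(2)[of "A v"] by (auto simp flip: A.diff)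
      then show ?thesis using AN by auto
    qed
    show "y \<in> N" if "A (B y) = 0" for y using B(2)[of y] that by simp
  qed
qed

section \<open>Preimage of a line under a local diffeomorphism\<close>

text \<open>The library's inverse function theorem is limited to Euclidean spaces; here only the
  preimage of a line is needed.\<close>

lemma inverse_curve:
  fixes \<phi> :: "'a::banach \<Rightarrow> 'a" and \<phi>' :: "'a \<Rightarrow> 'a \<Rightarrow>\<^sub>L 'a"
  assumes U: "open U" "x0 \<in> U"
    and der: "\<And>x. x \<in> U \<Longrightarrow> (\<phi> has_derivative \<phi>' x) (at x)"
    and cont: "continuous_on U \<phi>'"
    and id: "\<phi>' x0 = id_blinfun"
  obtains \<epsilon> c w where "\<epsilon> > 0" "c 0 = x0"
    "\<And>t. \<bar>t\<bar> < \<epsilon> \<Longrightarrow> c t \<in> U"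
    "\<And>t. \<bar>t\<bar> < \<epsilon> \<Longrightarrow> \<phi> (c t) = \<phi> x0 + t *\<^sub>R h"
    "\<And>t. \<bar>t\<bar> < \<epsilon> \<Longrightarrow> (c has_vector_derivative w t) (at t)"
    "continuous_on {-\<epsilon><..<\<epsilon>} w" "w 0 = h"
proof -
  obtain d1 where d1: "d1 > 0" "cball x0 d1 \<subseteq> U"
    using U open_contains_cball by blast
  obtain d2 where d2: "d2 > 0" "\<And>x. x \<in> U \<Longrightarrow> dist x x0 < d2 \<Longrightarrow> dist (\<phi>' x) (\<phi>' x0) < 1/2"
    using cont U(2) unfolding continuous_on_iff by (metis half_gt_zero zero_less_one)
  \<comment> \<open>Halving \<open>d2\<close> fits the closed ball \<open>D\<close> into the open
    ball on which \<open>\<phi>'\<close> is close to the identity. A closed ball is complete, as the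
    fixed point argument requires, and convex, as the mean value inequality requires.\<close>
  define \<delta> where "\<delta> = min d1 (d2/2)"
  define D where "D = cball x0 \<delta>"
  have \<delta>: "\<delta> > 0" using d1 d2 by (simp add: \<delta>_def)
  have DU: "D \<subseteq> U" using d1 by (auto simp: D_def \<delta>_def)
  have near: "norm (id_blinfun - \<phi>' x) \<le> 1/2" if "x \<in> D" for x
  proof -
    have "dist (\<phi>' x) (\<phi>' x0) < 1/2"
      using that DU d2 by (intro d2) (auto simp: D_def \<delta>_def dist_commute)
    then show ?thesis by (simp add: id dist_norm norm_minus_commute)
  qed
  have near': "norm (v - \<phi>' x v) \<le> norm v / 2" if "x \<in> D" for x v
  proof -
    have "norm (v - \<phi>' x v) = norm ((id_blinfun - \<phi>' x) v)" by (simp add: blinfun.diff_left)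
    also have "\<dots> \<le> norm (id_blinfun - \<phi>' x) * norm v" by (rule norm_blinfun)
    also have "\<dots> \<le> 1/2 * norm v" by (intro mult_right_mono near that) simp
    finally show ?thesis by simp
  qed
  have lower: "norm v \<le> 2 * norm (\<phi>' x v)" if "x \<in> D" for x v
    using near'[OF that, of v] norm_triangle_ineq[of "v - \<phi>' x v" "\<phi>' x v"] by simp
  have lip: "norm ((x - \<phi> x) - (y - \<phi> y)) \<le> 1/2 * norm (x - y)" if "x \<in> D" "y \<in> D" for x y
  proof (rule differentiable_bound[of D "\<lambda>x. x - \<phi> x" "\<lambda>x. blinfun_apply (id_blinfun - \<phi>' x)"])
    fix z assume "z \<in> D"
    then have "((\<lambda>x. x - \<phi> x) has_derivative (\<lambda>v. v - \<phi>' z v)) (at z)"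
      using DU der by (intro has_derivative_diff has_derivative_ident) auto
    then show "((\<lambda>x. x - \<phi> x) has_derivative blinfun_apply (id_blinfun - \<phi>' z)) (at z within D)"
      by (simp add: blinfun.diff_left[abs_def] has_derivative_at_withinI)
    show "onorm (blinfun_apply (id_blinfun - \<phi>' z)) \<le> 1/2"
      using near[OF \<open>z \<in> D\<close>] by (simp add: norm_blinfun.rep_eq)
  qed (use that in \<open>auto simp: D_def\<close>)
  have expand: "norm (x - y) \<le> 2 * norm (\<phi> x - \<phi> y)" if "x \<in> D" "y \<in> D" for x y
    using lip[OF that] norm_triangle_ineq[of "(x - \<phi> x) - (y - \<phi> y)" "\<phi> x - \<phi> y"] by simp
  \<comment> \<open>Chosen so that the shift \<open>t *\<^sub>R h\<close> has norm at most
    \<open>\<delta> / 2\<close>; the contraction contributes another \<open>\<delta> / 2\<close>, so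
    \<open>?F\<close> below maps \<open>D\<close> into itself. The summand 1 covers
    \<open>h = 0\<close>.\<close>
  define \<epsilon> where "\<epsilon> = \<delta> / (2 * (norm h + 1))"
  have h1: "norm h + 1 > 0" by (simp add: add_nonneg_pos)
  have \<epsilon>: "\<epsilon> > 0" using \<delta> h1 by (simp add: \<epsilon>_def)
  have "\<exists>x. x \<in> D \<and> \<phi> x = \<phi> x0 + t *\<^sub>R h" if t: "\<bar>t\<bar> < \<epsilon>" for t
  proof -
    \<comment> \<open>Newton iteration with the derivative frozen at the identity: its fixed points
      are the solutions of the equation for \<open>x\<close>.\<close>
    let ?F = "\<lambda>x. (x - \<phi> x) + (\<phi> x0 + t *\<^sub>R h)"
    have "norm (t *\<^sub>R h) \<le> \<epsilon> * (norm h + 1)" using t by (auto intro!: mult_mono)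
    also have "\<dots> = \<delta> / 2" using h1 by (simp add: \<epsilon>_def divide_simps)
    finally have th: "norm (t *\<^sub>R h) \<le> \<delta> / 2" .
    have "\<exists>!x\<in>D. ?F x = x"
    proof (rule Banach_fix[of D "1/2"])
      show "complete D" by (simp add: D_def complete_eq_closed)
      show "D \<noteq> {}" using \<delta> by (auto simp: D_def)
      show "?F ` D \<subseteq> D"
      proof (rule image_subsetI)
        fix x assume x: "x \<in> D"
        have x0: "x0 \<in> D" using \<delta> by (simp add: D_def)
        have "norm (?F x - x0) = norm (((x - \<phi> x) - (x0 - \<phi> x0)) + t *\<^sub>R h)"
          by (simp add: algebra_simps)
        also have "\<dots> \<le> norm ((x - \<phi> x) - (x0 - \<phi> x0)) + norm (t *\<^sub>R h)"
          by (rule norm_triangle_ineq)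
        also have "\<dots> \<le> 1/2 * norm (x - x0) + \<delta>/2" by (intro add_mono lip x x0 th)
        also have "\<dots> \<le> \<delta>" using x by (simp add: D_def dist_norm norm_minus_commute)
        finally show "?F x \<in> D" by (simp add: D_def dist_norm norm_minus_commute)
      qed
      show "dist (?F x) (?F y) \<le> 1/2 * dist x y" if "x \<in> D" "y \<in> D" for x y
        using lip[OF that] by (simp add: dist_norm)
    qed auto
    then obtain x where x: "x \<in> D" "?F x = x" by blast
    have "(\<phi> x0 + t *\<^sub>R h) - \<phi> x = ?F x - x" by simp
    then have "\<phi> x = \<phi> x0 + t *\<^sub>R h" unfolding x(2) by simp
    with x(1) show ?thesis by blast
  qed
  then have "\<forall>t. \<exists>x. \<bar>t\<bar> < \<epsilon> \<longrightarrow> x \<in> D \<and> \<phi> x = \<phi> x0 + t *\<^sub>R h" by blast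
  from choice[OF this]
  obtain c where cD: "\<And>t. \<bar>t\<bar> < \<epsilon> \<Longrightarrow> c t \<in> D"
    and c\<phi>: "\<And>t. \<bar>t\<bar> < \<epsilon> \<Longrightarrow> \<phi> (c t) = \<phi> x0 + t *\<^sub>R h"
    by blast
  \<comment> \<open>The candidate velocity solves the differentiated equation. The contraction
    principle supplies it from closeness to the identity, without constructing an inverse
    operator.\<close>
  have "\<exists>v. \<phi>' x v = h" if "x \<in> D" for x
  proof -
    have "\<exists>!v. (v - \<phi>' x v) + h = v"
    proof (rule banach_fix_type[of "1/2"])
      show "\<forall>v u. dist ((v - \<phi>' x v) + h) ((u - \<phi>' x u) + h) \<le> 1/2 * dist v u"
      proof (intro allI)
        fix v u
        have "((v - \<phi>' x v) + h) - ((u - \<phi>' x u) + h) = (v - u) - \<phi>' x (v - u)"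
          by (simp add: blinfun.diff_right)
        then have "dist ((v - \<phi>' x v) + h) ((u - \<phi>' x u) + h) = norm ((v - u) - \<phi>' x (v - u))"
          by (simp only: dist_norm)
        also have "\<dots> \<le> 1/2 * dist v u"
          using near'[OF that, of "v - u"] by (simp add: dist_norm)
        finally show "dist ((v - \<phi>' x v) + h) ((u - \<phi>' x u) + h) \<le> 1/2 * dist v u" .
      qed
    qed auto
    then obtain v where v: "(v - \<phi>' x v) + h = v" by blast
    have "h - \<phi>' x v = ((v - \<phi>' x v) + h) - v" by simp
    then have "\<phi>' x v = h" unfolding v by simp
    then show ?thesis ..
  qed
  then obtain w0 where w0: "\<And>x. x \<in> D \<Longrightarrow> \<phi>' x (w0 x) = h" by metis
  define w where "w t = w0 (c t)" for t
  have w: "\<phi>' (c t) (w t) = h" if "\<bar>t\<bar> < \<epsilon>" for t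
    using w0 cD that by (simp add: w_def)
  \<comment> \<open>Both points lie in \<open>D\<close> and have the same image, and
    \<open>expand\<close> makes \<open>\<phi>\<close> injective there.\<close>
  have c0: "c 0 = x0"
    using expand[of "c 0" x0] cD[of 0] c\<phi>[of 0] \<epsilon> \<delta> by (simp add: D_def)
  have clip: "norm (c s - c t) \<le> 2 * norm h * \<bar>s - t\<bar>" if "\<bar>s\<bar> < \<epsilon>" "\<bar>t\<bar> < \<epsilon>" for s t
  proof -
    have "\<phi> (c s) - \<phi> (c t) = (s - t) *\<^sub>R h" using that c\<phi> by (simp add: algebra_simps)
    then show ?thesis using expand[of "c s" "c t"] cD that by (simp add: mult_ac)
  qed
  have cder: "(c has_vector_derivative w t) (at t)" if t: "\<bar>t\<bar> < \<epsilon>" for t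
    unfolding has_vector_derivative_def has_derivative_at_alt
  proof (intro conjI allI impI bounded_linear_scaleR_left)
    fix e :: real assume e: "e > 0"
    \<comment> \<open>The 4 is a factor 2 from the Lipschitz bound \<open>clip\<close> times a
      factor 2 from \<open>lower\<close>.\<close>
    define e' where "e' = e / (4 * (norm h + 1))"
    have e': "e' > 0" using e h1 by (simp add: e'_def)
    obtain d where d: "d > 0" "\<And>z. norm (z - c t) < d \<Longrightarrow>
        norm (\<phi> z - \<phi> (c t) - \<phi>' (c t) (z - c t)) \<le> e' * norm (z - c t)"
      using der[of "c t"] cD[OF t] DU e' unfolding has_derivative_at_alt by blast
    \<comment> \<open>The first entry keeps \<open>s\<close> in the parameter interval; the second,
      through \<open>clip\<close>, brings \<open>c s\<close> within \<open>d\<close> of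
      \<open>c t\<close>.\<close>
    define d' where "d' = min (\<epsilon> - \<bar>t\<bar>) (d / (2 * (norm h + 1)))"
    show "\<exists>d>0. \<forall>s. norm (s - t) < d \<longrightarrow>
        norm (c s - c t - (s - t) *\<^sub>R w t) \<le> e * norm (s - t)"
    proof (intro exI[of _ d'] conjI allI impI)
      show "d' > 0" using t d(1) h1 by (simp add: d'_def)
      fix s assume "norm (s - t) < d'"
      then have s: "\<bar>s\<bar> < \<epsilon>" and sd: "\<bar>s - t\<bar> * (2 * (norm h + 1)) < d"
        using h1 by (auto simp: d'_def pos_less_divide_eq)
      have b: "norm (c s - c t) \<le> (2 * (norm h + 1)) * \<bar>s - t\<bar>"
        by (rule order_trans[OF clip[OF s t]]) (intro mult_right_mono, auto)
      then have "norm (c s - c t) < d" using sd by (simp add: mult.commute)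
      note d(2)[OF this]
      \<comment> \<open>Since \<open>\<phi>' (c t)\<close> sends \<open>w t\<close> to
        \<open>h\<close>, the increment of \<open>\<phi>\<close> along \<open>c\<close> is the image
        of \<open>(s - t) *\<^sub>R w t\<close>. The remainder of \<open>\<phi>\<close> thus
        controls the image of the remainder of \<open>c\<close>, and \<open>lower\<close> removes
        the operator.\<close>
      also have "\<phi> (c s) - \<phi> (c t) - \<phi>' (c t) (c s - c t) = - \<phi>' (c t) (c s - c t - (s - t) *\<^sub>R w t)"
        using c\<phi> s t w[OF t] by (simp add: blinfun.bilinear_simps algebra_simps)
      finally have "norm (\<phi>' (c t) (c s - c t - (s - t) *\<^sub>R w t)) \<le> e' * norm (c s - c t)"
        by simp
      also have "\<dots> \<le> e' * ((2 * (norm h + 1)) * \<bar>s - t\<bar>)" using b e' by (intro mult_left_mono) auto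
      also have "\<dots> = e / 2 * \<bar>s - t\<bar>" using h1 by (simp add: e'_def field_simps)
      finally show "norm (c s - c t - (s - t) *\<^sub>R w t) \<le> e * norm (s - t)"
        using lower[OF cD[OF t], of "c s - c t - (s - t) *\<^sub>R w t"] by simp
    qed
  qed
  have "continuous_on {-\<epsilon><..<\<epsilon>} c"
    by (intro continuous_at_imp_continuous_on ballI has_vector_derivative_continuous[OF cder]) auto
  then have contc: "continuous_on {-\<epsilon><..<\<epsilon>} (\<lambda>t. \<phi>' (c t))"
    by (rule continuous_on_compose2[OF cont]) (use cD DU in \<open>auto simp: abs_less_iff\<close>)
  have "continuous_on {-\<epsilon><..<\<epsilon>} w"
    unfolding continuous_on_def
  proof
    fix t assume "t \<in> {-\<epsilon><..<\<epsilon>}"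
    then have t: "\<bar>t\<bar> < \<epsilon>" by auto
    have lim: "((\<lambda>s. 2 * (norm (\<phi>' (c t) - \<phi>' (c s)) * norm (w t))) \<longlongrightarrow>
        2 * (norm (\<phi>' (c t) - \<phi>' (c t)) * norm (w t))) (at t within {-\<epsilon><..<\<epsilon>})"
      using contc \<open>t \<in> _\<close> by (intro tendsto_intros) (auto simp: continuous_on_def)
    have "((\<lambda>s. w s - w t) \<longlongrightarrow> 0) (at t within {-\<epsilon><..<\<epsilon>})"
    proof (rule Lim_null_comparison)
      \<comment> \<open>Both \<open>\<phi>' (c s) (w s)\<close> and
        \<open>\<phi>' (c t) (w t)\<close> equal \<open>h\<close>, so the variation of
        \<open>w\<close> is governed by that of the operators.\<close>
      have "norm (w s - w t) \<le> 2 * (norm (\<phi>' (c t) - \<phi>' (c s)) * norm (w t))"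
        if s: "\<bar>s\<bar> < \<epsilon>" for s
      proof -
        have "\<phi>' (c s) (w s - w t) = (\<phi>' (c t) - \<phi>' (c s)) (w t)"
          using w s t by (simp add: blinfun.diff_left blinfun.diff_right)
        then show ?thesis
          using lower[OF cD[OF s], of "w s - w t"] norm_blinfun[of "\<phi>' (c t) - \<phi>' (c s)" "w t"]
          by simp
      qed
      then show "\<forall>\<^sub>F s in at t within {-\<epsilon><..<\<epsilon>}.
          norm (w s - w t) \<le> 2 * (norm (\<phi>' (c t) - \<phi>' (c s)) * norm (w t))"
        by (auto simp: eventually_at_filter abs_less_iff intro!: always_eventually)
    qed (use lim in simp)
    then show "(w \<longlongrightarrow> w t) (at t within {-\<epsilon><..<\<epsilon>})"
      using Lim_null by blast
  qed
  moreover have "w 0 = h" using w[of 0] \<epsilon> by (simp add: c0 id)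
  moreover have "c t \<in> U" if "\<bar>t\<bar> < \<epsilon>" for t using cD[OF that] DU by auto
  ultimately show thesis
    using \<epsilon> c0 c\<phi> cder by (intro that[of \<epsilon> c w]) auto
qed

section \<open>Curves in the level set with prescribed velocity\<close>

text \<open>Regularity enters twice: the splittings at \<open>x\<close> give \<open>B\<close> and
  hence the curve, and the trivial intersections near \<open>x\<close> keep the curve in the level
  set.\<close>

lemma level_set_tangent_curve:
  fixes g :: "'a::banach \<Rightarrow> 'b::banach"
  assumes U: "open U" and g: "C1_on U g" and reg: "generalized_regular_point U g x"
    and h: "h \<in> nullspace (frechet_derivative g (at x))"
  obtains \<epsilon> c where "\<epsilon> > 0" "c C1_differentiable_on {-\<epsilon><..<\<epsilon>}"
    "c ` {-\<epsilon><..<\<epsilon>} \<subseteq> level_set U g (g x)" "c 0 = x" "(c has_vector_derivative h) (at 0)"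
proof -
  obtain g' :: "'a \<Rightarrow> 'a \<Rightarrow>\<^sub>L 'b" where g': "\<And>z. z \<in> U \<Longrightarrow> (g has_derivative g' z) (at z)"
    and contg: "continuous_on U g'"
    using g unfolding C1_on_def by blast
  have fd: "frechet_derivative g (at z) = g' z" if "z \<in> U" for z
    using frechet_derivative_at[OF g'[OF that]] by simp
  have xU: "x \<in> U" using reg by (simp add: generalized_regular_point_def)
  obtain R where R: "closed R" "direct_sum_decomp (nullspace (g' x)) R"
    using reg xU by (auto simp: generalized_regular_point_def double_split_def fd)
  \<comment> \<open>The complement is taken from the neighbourhood condition, because
    \<open>B\<close> must be built from the same \<open>N\<close> that meets the nearby ranges
    trivially.\<close>
  obtain N W where N: "closed N" "direct_sum_decomp (range (g' x)) N"
    and W: "open W" "x \<in> W" "W \<subseteq> U" and triv: "\<And>z. z \<in> W \<Longrightarrow> range (g' z) \<inter> N = {0}"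
    using reg xU unfolding generalized_regular_point_def fd[OF xU]
    by (metis fd subsetD)
  obtain B0 where "bounded_linear B0" and B0: "\<And>v. g' x (B0 (g' x v)) = g' x v"
    "\<And>y. g' x (B0 y) = 0 \<Longrightarrow> y \<in> N"
    using double_split_generalized_inverse[OF blinfun.bounded_linear_right R N] by blast
  then obtain B where B: "\<And>v. g' x (blinfun_apply B (g' x v)) = g' x v"
    "\<And>y. g' x (blinfun_apply B y) = 0 \<Longrightarrow> y \<in> N"
    using bounded_linear_Blinfun_apply by metis
  define \<phi> where "\<phi> z = (z - x) - B (g' x (z - x)) + B (g z - g x)" for z
  define \<phi>' where "\<phi>' z = id_blinfun - (B o\<^sub>L g' x) + (B o\<^sub>L g' z)" for z
  have der: "(\<phi> has_derivative \<phi>' z) (at z)" if "z \<in> W" for z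
    unfolding \<phi>_def[abs_def] \<phi>'_def using g'[of z] that W
    by (auto intro!: derivative_eq_intros simp: blinfun.bilinear_simps)
  have cont: "continuous_on W \<phi>'"
    unfolding \<phi>'_def[abs_def] using continuous_on_subset[OF contg W(3)]
    by (intro continuous_intros)
  have "\<phi>' x = id_blinfun" by (simp add: \<phi>'_def)
  \<comment> \<open>Using \<open>W\<close> as the domain keeps the whole curve where
    \<open>triv\<close> applies.\<close>
  from inverse_curve[OF W(1,2) der cont this, of h]
  obtain \<epsilon> c w where \<epsilon>: "\<epsilon> > 0" and c0: "c 0 = x" and cW: "\<And>t. \<bar>t\<bar> < \<epsilon> \<Longrightarrow> c t \<in> W"
    and c\<phi>: "\<And>t. \<bar>t\<bar> < \<epsilon> \<Longrightarrow> \<phi> (c t) = \<phi> x + t *\<^sub>R h"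
    and cder: "\<And>t. \<bar>t\<bar> < \<epsilon> \<Longrightarrow> (c has_vector_derivative w t) (at t)"
    and contw: "continuous_on {-\<epsilon><..<\<epsilon>} w" and w0: "w 0 = h"
    by metis
  have Ah: "g' x h = 0" using h xU by (simp add: nullspace_def fd)
  define G where "G t = g' x (B (g (c t) - g x))" for t
  \<comment> \<open>By \<open>A B A = A\<close> for \<open>A = g' x\<close>, the first two terms of
    \<open>\<phi>\<close> are annihilated by \<open>A\<close>, so \<open>G t\<close> is
    \<open>A\<close> applied to \<open>\<phi> (c t) = t *\<^sub>R h\<close>, and \<open>h\<close> is
    in the null space.\<close>
  have G0: "G t = 0" if "\<bar>t\<bar> < \<epsilon>" for t
  proof -
    have "g' x (\<phi> (c t)) = G t"
      by (simp add: \<phi>_def G_def blinfun.add_right blinfun.diff_right B)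
    moreover have "g' x (\<phi> (c t)) = 0"
      using c\<phi>[OF that] Ah by (simp add: \<phi>_def blinfun.bilinear_simps)
    ultimately show ?thesis by simp
  qed
  have gc: "((\<lambda>t. g (c t)) has_vector_derivative g' (c t) (w t)) (at t)" if "\<bar>t\<bar> < \<epsilon>" for t
    using has_derivative_compose[OF cder[OF that, unfolded has_vector_derivative_def] g'[of "c t"]]
      cW[OF that] W(3)
    by (auto simp: has_vector_derivative_def blinfun.scaleR_right)
  have zero: "g' (c t) (w t) = 0" if t: "\<bar>t\<bar> < \<epsilon>" for t
  proof -
    have "(G has_vector_derivative g' x (B (g' (c t) (w t)))) (at t)"
      unfolding G_def[abs_def]
      by (intro bounded_linear.has_vector_derivative[OF blinfun.bounded_linear_right])
         (auto intro!: derivative_eq_intros gc t)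
    moreover have "(G has_vector_derivative 0) (at t)"
      by (rule has_vector_derivative_transform_within_open[of "\<lambda>_. 0" _ _ "{-\<epsilon><..<\<epsilon>}"])
         (use t G0 in auto)
    ultimately have "g' x (B (g' (c t) (w t))) = 0"
      by (rule vector_derivative_unique_at)
    then have "g' (c t) (w t) \<in> range (g' (c t)) \<inter> N" using B(2) by blast
    then show ?thesis using triv[OF cW[OF t]] by blast
  qed
  have const: "g (c t) = g x" if "\<bar>t\<bar> < \<epsilon>" for t
  proof -
    have "g (c t) = g (c 0)"
    proof (rule has_derivative_zero_unique[of "{-\<epsilon><..<\<epsilon>}" "\<lambda>t. g (c t)"])
      fix s assume "s \<in> {-\<epsilon><..<\<epsilon>}"
      then have s: "\<bar>s\<bar> < \<epsilon>" by auto
      show "((\<lambda>t. g (c t)) has_derivative (\<lambda>h. 0)) (at s within {-\<epsilon><..<\<epsilon>})"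
        using gc[OF s] zero[OF s] by (simp add: has_vector_derivative_def has_derivative_at_withinI)
    qed (use that \<epsilon> in auto)
    then show ?thesis by (simp add: c0)
  qed
  show thesis
  proof
    show "c C1_differentiable_on {-\<epsilon><..<\<epsilon>}"
      unfolding C1_differentiable_on_def using cder contw by (intro exI[of _ w]) auto
    show "c ` {-\<epsilon><..<\<epsilon>} \<subseteq> level_set U g (g x)"
      using cW W(3) const by (force simp: level_set_def)
    show "(c has_vector_derivative h) (at 0)" using cder[of 0] \<epsilon> w0 by simp
  qed (use \<epsilon> c0 in auto)
qed

section \<open>Necessary condition at a critical point\<close>

theorem theorem2p1:
  fixes U :: "'a::banach set" and g :: "'a \<Rightarrow> 'b::banach" and f :: "'a \<Rightarrow> real"
    and y0 :: 'b and x :: 'a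
  assumes "open U"
    and "C1_on U g"
    and "C1_on U f"
    and "generalized_regular_value U g y0"
    and "x \<in> U"
    and "critical_point_on f (level_set U g y0) x"
  shows "nullspace (frechet_derivative g (at x)) \<subseteq> nullspace (frechet_derivative f (at x)) \<and> g x = y0"
proof
  have xS: "x \<in> level_set U g y0" using assms(6) by (simp add: critical_point_on_def)
  then show gx: "g x = y0" by (simp add: level_set_def)
  have reg: "generalized_regular_point U g x"
    using assms(4) xS by (simp add: generalized_regular_value_def)
  obtain f' :: "'a \<Rightarrow>\<^sub>L real" where f': "(f has_derivative f') (at x)"
    using assms(3,5) unfolding C1_on_def by blast
  show "nullspace (frechet_derivative g (at x)) \<subseteq> nullspace (frechet_derivative f (at x))"
  proof
    fix h assume h: "h \<in> nullspace (frechet_derivative g (at x))"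
    obtain \<epsilon> c where \<epsilon>: "\<epsilon> > 0" and c: "c C1_differentiable_on {-\<epsilon><..<\<epsilon>}"
      "c ` {-\<epsilon><..<\<epsilon>} \<subseteq> level_set U g y0" "c 0 = x" "(c has_vector_derivative h) (at 0)"
      using level_set_tangent_curve[OF assms(1,2) reg h] gx by metis
    \<comment> \<open>The derivative of \<open>f\<close> along the curve is computed twice: it
      vanishes by criticality and equals \<open>f' h\<close> by the chain rule.\<close>
    have "((\<lambda>t. f (c t)) has_vector_derivative 0) (at 0)"
      using assms(6) \<epsilon> c
      by (simp add: critical_point_on_def has_real_derivative_iff_has_vector_derivative)
    moreover have "((\<lambda>t. f (c t)) has_vector_derivative f' h) (at 0)"
      using has_derivative_compose[OF c(4)[unfolded has_vector_derivative_def], of f f'] f' c(3)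
      by (simp add: has_vector_derivative_def blinfun.scaleR_right)
    ultimately have "f' h = 0" using vector_derivative_unique_at by blast
    then show "h \<in> nullspace (frechet_derivative f (at x))"
      using frechet_derivative_at[OF f'] by (simp add: nullspace_def)
  qed
qed

end
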